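(* Let $\{\hat\theta_n\}$ be estimators of $\theta\in\Theta\subset\mathbb{R}^d$ with $r_n(\hat\theta_n-\theta)\overset{d}{\rightarrow}Z$, whatever is the true value of $\theta$, where $r_n\rightarrow\infty$ are deterministic scalars and $Z$ is a $d$-dimensional random vector with mean zero and covariance matrix $V^{-1}$. Let $c=(c_1,\dots,c_d)'$ be a known $d$-vector, let $(a_{nj})=(a_{n1},\dots,a_{nd})$, $n=1,2,\dots$, be $d$-vectors with positive components, and let $\tilde\theta_n(c)$ be the corresponding oracle Hodges' estimator (defined in the context). If $$\max_{1\le j\le d}a_{nj}\rightarrow0\quad\text{and}\quad r_n\min_{1\le j\le d}a_{nj}\rightarrow\infty\quad\text{as }n\rightarrow\infty,$$ then, whatever is the true value of $\theta$: for any $b\subset\{1,2,\dots,d\}$ with complement $\bar b$, $\theta_{\bar b}=c_{\bar b}$ implies $$\lim_{n\rightarrow\infty}\Pr\nolimits_\theta(\tilde\theta_{n,\bar b}(c)=\theta_{\bar b})=1,$$ and $$r_n(\tilde\theta_n(c)-\theta)\overset{d}{\rightarrow}\begin{pmatrix}\check Z_{b(\theta)}\\0\end{pmatrix}\quad\text{under }\Pr\nolimits_\theta,$$ where components are arranged with the indices in $b(\theta)=\{j:\theta_j\neq c_j\}$ first and those in $\bar b(\theta)=\{1,\dots,d\}\setminus b(\theta)$ last.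
   Context: The distribution of $Z$, and hence $V^{-1}$, may depend on $\theta$; $V^{-1}$ is required to be a continuous function of $\theta$. $\hat V^{-1}$ denotes any consistent estimator of $V^{-1}$, and $\hat V$ its inverse. For $b\subset\{1,\dots,d\}$ with complement $\bar b$, vectors are rearranged as $\theta=(\theta_b',\theta_{\bar b}')'$, $\hat\theta_n=(\hat\theta_{n,b}',\hat\theta_{n,\bar b}')'$, $Z=(Z_b',Z_{\bar b}')'$, and $V=\begin{pmatrix}V_{bb}&V_{b\bar b}\\ V_{\bar bb}&V_{\bar b\bar b}\end{pmatrix}$ is partitioned correspondingly (likewise $\hat V$). For $\emptyset\neq b\neq\{1,\dots,d\}$ put $\check\theta_{n,b}=\hat\theta_{n,b}+\hat V_{bb}^{-1}\hat V_{b\bar b}(\hat\theta_{n,\bar b}-c_{\bar b})$. Oracle Hodges' estimator: let $b_n(c)=\{j:|\hat\theta_{nj}-c_j|>a_{nj}\}$ and $\bar b_n(c)=\{j:|\hat\theta_{nj}-c_j|\le a_{nj}\}$ (random sets). Then $\tilde\theta_n(c)=\hat\theta_n$ if $b_n(c)=\{1,\dots,d\}$; $\tilde\theta_n(c)=c$ if $b_n(c)=\emptyset$; otherwise $\tilde\theta_n(c)=(\check\theta_{n,b_n(c)}',c_{\bar b_n(c)}')'$, i.e. its subvector with indices in $b_n(c)$ is $\check\theta_{n,b}$ evaluated at $b=b_n(c)$ and its subvector with indices in $\bar b_n(c)$ is $c_{\bar b_n(c)}$. $\tilde\theta_{n,\bar b}(c)$ denotes the subvector of $\tilde\theta_n(c)$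 with indices in $\bar b$. $\check Z_b=V_{bb}^{-1}(V_{bb}\ \ V_{b\bar b})Z$ if $b\neq\emptyset$ (with $Z$ arranged as $(Z_b',Z_{\bar b}')'$), and $\check Z_b=0$ if $b=\emptyset$; $\check Z_{b(\theta)}$ is this with $b=b(\theta)$. $\Pr_\theta$ is the probability under true parameter $\theta$; $\overset{d}{\rightarrow}$ is convergence in distribution. *)

theory Defs
  imports "HOL-Probability.Probability"
begin

text \<open>
  Convergence in distribution for random elements of a topological space, by bounded continuous
  test functions; the library's \<open>weak_conv_m\<close> only covers laws on the real line.
  The limit may live on a different probability space.
\<close>

definition conv_in_distribution ::
  "'a measure \<Rightarrow> (nat \<Rightarrow> 'a \<Rightarrow> 'v::topological_space) \<Rightarrow> 'b measure \<Rightarrow> ('b \<Rightarrow> 'v) \<Rightarrow> bool" where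
  "conv_in_distribution M X N Y \<longleftrightarrow>
     (\<forall>n. X n \<in> borel_measurable M) \<and> Y \<in> borel_measurable N \<and>
     (\<forall>f :: 'v \<Rightarrow> real. continuous_on UNIV f \<longrightarrow> bounded (range f) \<longrightarrow>
        (\<lambda>n. \<integral>\<omega>. f (X n \<omega>) \<partial>M) \<longlonglongrightarrow> (\<integral>\<omega>. f (Y \<omega>) \<partial>N))"

definition conv_in_probability ::
  "'a measure \<Rightarrow> (nat \<Rightarrow> 'a \<Rightarrow> 'v::metric_space) \<Rightarrow> 'v \<Rightarrow> bool" where
  "conv_in_probability M X x \<longleftrightarrow>
     (\<forall>\<epsilon>>0. (\<lambda>n. measure M {\<omega> \<in> space M. dist (X n \<omega>) x > \<epsilon>}) \<longlonglongrightarrow> 0)"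

definition covariance_matrix :: "'b measure \<Rightarrow> ('b \<Rightarrow> real ^ 'd) \<Rightarrow> real ^ 'd ^ 'd" where
  "covariance_matrix M X =
     (\<chi> i j. \<integral>\<omega>. (X \<omega> $ i - (\<integral>\<omega>'. X \<omega>' $ i \<partial>M)) * (X \<omega> $ j - (\<integral>\<omega>'. X \<omega>' $ j \<partial>M)) \<partial>M)"

text \<open>
  For index sets \<open>b\<close>, \<open>b'\<close> the subvector \<open>x\<^sub>b\<close> and the submatrix \<open>A\<^bsub>bb'\<^esub>\<close> keep their original indices
  and are padded with zeros outside \<open>b\<close> and outside \<open>b \<times> b'\<close>.  No permutation of the components
  is needed, and sums and products of padded blocks are the padded sums and products.
\<close>

definition subvec :: "'d set \<Rightarrow> real ^ 'd \<Rightarrow> real ^ 'd" where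
  "subvec b x = (\<chi> i. if i \<in> b then x $ i else 0)"

definition block :: "'d set \<Rightarrow> 'd set \<Rightarrow> real ^ 'd ^ 'd \<Rightarrow> real ^ 'd ^ 'd" where
  "block b b' A = (\<chi> i j. if i \<in> b \<and> j \<in> b' then A $ i $ j else 0)"

text \<open>
  The inverse of the \<open>b \<times> b\<close> submatrix, again zero-padded.  The identity matrix of size \<open>b\<close> is
  \<open>block b b (mat 1)\<close>.  Like \<^const>\<open>matrix_inv\<close>, this is a fixed arbitrary matrix
  if the submatrix is singular.
\<close>

definition block_inv :: "'d set \<Rightarrow> real ^ 'd ^ 'd \<Rightarrow> real ^ 'd ^ 'd" where
  "block_inv b A =
     (SOME B. block b b B = B \<and>
        block b b A ** B = block b b (mat 1) \<and> B ** block b b A = block b b (mat 1))"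

lemma block_inv_UNIV: "block_inv UNIV A = matrix_inv A" for A :: "real ^ 'd ^ 'd"
proof -
  have "block UNIV UNIV B = B" for B :: "real ^ 'd ^ 'd"
    by (simp add: block_def)
  then show ?thesis
    by (simp add: block_inv_def matrix_inv_def)
qed

text \<open>
  In the next three definitions \<open>t\<close> and \<open>V\<close> stand for the realized values of the initial
  estimator and of the estimator of \<open>V\<close>, and \<open>a\<close> for the vector of thresholds.
\<close>

definition restricted_estimate ::
  "real ^ 'd \<Rightarrow> 'd set \<Rightarrow> real ^ 'd ^ 'd \<Rightarrow> real ^ 'd \<Rightarrow> real ^ 'd" where
  "restricted_estimate c b V t =
     subvec b t + (block_inv b V ** block b (- b) V) *v subvec (- b) (t - c)"

definition selected :: "real ^ 'd \<Rightarrow> real ^ 'd \<Rightarrow> real ^ 'd \<Rightarrow> 'd set" where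
  "selected c a t = {j. \<bar>t $ j - c $ j\<bar> > a $ j}"

definition oracle_hodges ::
  "real ^ 'd \<Rightarrow> real ^ 'd \<Rightarrow> real ^ 'd ^ 'd \<Rightarrow> real ^ 'd \<Rightarrow> real ^ 'd" where
  "oracle_hodges c a V t =
     (let b = selected c a t in
      if b = UNIV then t
      else if b = {} then c
      else (\<chi> j. if j \<in> b then restricted_estimate c b V t $ j else c $ j))"

definition Z_check :: "'d set \<Rightarrow> real ^ 'd ^ 'd \<Rightarrow> real ^ 'd \<Rightarrow> real ^ 'd" where
  "Z_check b V z = (if b = {} then 0 else (block_inv b V ** block b UNIV V) *v z)"

end

theory Submission imports Defs begin

text \<open>
  By tightness \<open>r n *\<^sub>R (\<theta>hat n - \<theta>)\<close> is bounded by some \<open>K\<close> with probability close to one.  The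
  thresholds vanish but dominate \<open>1 / r n\<close>, so for large \<open>n\<close> this bound alone forces the selected
  set to be \<open>b(\<theta>)\<close>.  Once it is, the normalized error of the oracle Hodges estimator is a matrix
  depending on the estimate of \<open>V\<close> applied to \<open>r n *\<^sub>R (\<theta>hat n - \<theta>)\<close>, because \<open>\<theta>\<close> agrees
  with the known vector outside \<open>b(\<theta>)\<close>.  That matrix is consistent: \<open>V\<close> is the inverse of a
  covariance matrix, hence positive definite, so its diagonal blocks are invertible and block
  inversion is continuous there.  Slutsky's theorem gives the limit.
\<close>

section \<open>Inverses of diagonal blocks\<close>

lemma matrix_add_rdistrib: "(A + B) ** C = A ** C + B ** C" for A B :: "'a::semiring_1 ^ 'n ^ 'm"
  by (vector matrix_matrix_mult_def sum.distrib[symmetric] field_simps)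

lemma matrix_mult_zero [simp]: "0 ** A = 0" "A ** 0 = 0"
  by (simp_all add: matrix_matrix_mult_def vec_eq_iff)

lemma block_mat1_nth: "block b b (mat 1) $ i $ j = (if i = j \<and> i \<in> b then 1 else 0 :: real)"
  by (auto simp: block_def mat_def)

lemma block_mat1_mult_vec: "block b b (mat 1) *v x = subvec b x" for x :: "real ^ 'd"
proof -
  have "(\<Sum>j\<in>UNIV. block b b (mat 1) $ i $ j * x $ j) =
      (\<Sum>j\<in>UNIV. if j = i then (if i \<in> b then x $ i else 0) else 0)" for i
    by (rule sum.cong) (auto simp: block_mat1_nth)
  then show ?thesis
    by (simp add: vec_eq_iff subvec_def matrix_vector_mult_def)
qed

text \<open>\<open>block b b (mat 1)\<close> is the coordinate projection onto \<open>b\<close>, so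
  cutting out a block is a two-sided compression. Block identities thereby reduce to algebra with
  diagonal idempotents.\<close>

lemma block_eq_mult: "block b b' A = block b b (mat 1) ** A ** block b' b' (mat 1)"
  for A :: "real ^ 'd ^ 'd"
proof -
  have left: "(block b b (mat 1) ** A) $ i $ j = (if i \<in> b then A $ i $ j else 0)" for i j
  proof -
    have "(\<Sum>k\<in>UNIV. block b b (mat 1) $ i $ k * A $ k $ j) =
        (\<Sum>k\<in>UNIV. if k = i then (if i \<in> b then A $ i $ j else 0) else 0)"
      by (rule sum.cong) (auto simp: block_mat1_nth)
    then show ?thesis by (simp add: matrix_matrix_mult_def)
  qed
  have "(M ** block b' b' (mat 1)) $ i $ j = (if j \<in> b' then M $ i $ j else 0)"
    for M :: "real ^ 'd ^ 'd" and i j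
  proof -
    have "(\<Sum>k\<in>UNIV. M $ i $ k * block b' b' (mat 1) $ k $ j) =
        (\<Sum>k\<in>UNIV. if k = j then (if j \<in> b' then M $ i $ j else 0) else 0)"
      by (rule sum.cong) (auto simp: block_mat1_nth)
    then show ?thesis by (simp add: matrix_matrix_mult_def)
  qed
  then show ?thesis
    using left by (simp add: vec_eq_iff block_def)
qed

lemma block_mat1_mult_block_mat1:
  "block b b (mat 1) ** block b' b' (mat 1) = block (b \<inter> b') (b \<inter> b') (mat 1 :: real ^ 'd ^ 'd)"
  by (subst matrix_eq)
    (simp add: matrix_vector_mul_assoc[symmetric] block_mat1_mult_vec subvec_def vec_eq_iff)

lemma block_mult_block_mat1:
  "block b b A ** block b b (mat 1) = block b b A" "block b b (mat 1) ** block b b A = block b b A"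
  for A :: "real ^ 'd ^ 'd"
proof -
  have idem: "block b b (mat 1) ** block b b (mat 1) = block b b (mat 1 :: real ^ 'd ^ 'd)"
    by (simp add: block_mat1_mult_block_mat1)
  show "block b b A ** block b b (mat 1) = block b b A"
    unfolding block_eq_mult[of b b A] by (simp add: idem flip: matrix_mul_assoc)
  show "block b b (mat 1) ** block b b A = block b b A"
    unfolding block_eq_mult[of b b A] by (simp add: idem matrix_mul_assoc)
qed

lemma block_empty [simp]: "block {} b A = 0" "block b {} A = 0"
  by (simp_all add: block_def vec_eq_iff)

lemma block_add_compl: "block b b' A + block b (- b') A = block b UNIV A"
  by (auto simp: block_def vec_eq_iff)

lemma block_mat1_add_compl: "block b b (mat 1) + block (- b) (- b) (mat 1) = (mat 1 :: real ^ 'd ^ 'd)"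
  by (auto simp: block_def vec_eq_iff mat_def)

text \<open>
  Filling the complementary diagonal with ones turns invertibility of a block into
  invertibility of a full matrix.
\<close>

definition padded_block :: "'d set \<Rightarrow> real ^ 'd ^ 'd \<Rightarrow> real ^ 'd ^ 'd" where
  "padded_block b A = block b b A + block (- b) (- b) (mat 1)"

lemma matrix_inv_mult:
  fixes A :: "'a::field ^ 'd ^ 'd"
  assumes "invertible A"
  shows "A ** matrix_inv A = mat 1" "matrix_inv A ** A = mat 1"
  using someI_ex[OF assms[unfolded invertible_def]] by (simp_all add: matrix_inv_def)

text \<open>Uniqueness of two-sided inverses among matrices supported on the \<open>b\<close> block,
  where \<open>block b b (mat 1)\<close> acts as the unit; it pins down the choice made in
  \<open>block_inv\<close>.\<close>

lemma block_inv_eqI: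
  fixes A B :: "real ^ 'd ^ 'd"
  assumes "block b b B = B" "block b b A ** B = block b b (mat 1)" "B ** block b b A = block b b (mat 1)"
  shows "block_inv b A = B"
  unfolding block_inv_def
proof (rule some_equality)
  fix C :: "real ^ 'd ^ 'd"
  assume C: "block b b C = C \<and> block b b A ** C = block b b (mat 1) \<and> C ** block b b A = block b b (mat 1)"
  have "C = C ** block b b (mat 1)"
    using C block_mult_block_mat1(1)[of b C] by simp
  also have "\<dots> = C ** block b b A ** B"
    by (simp add: assms matrix_mul_assoc[symmetric])
  also have "\<dots> = block b b (mat 1) ** B"
    using C by simp
  also have "\<dots> = B"
    using assms(1) block_mult_block_mat1(2)[of b B] by simp
  finally show "C = B" .
qed (use assms in simp)

text \<open>The padded matrix is block diagonal, so it commutes with the projection \<open>D\<close>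
  onto \<open>b\<close>. Its inverse \<open>R\<close> then commutes with \<open>D\<close> too, and
  compressing \<open>R\<close> just gives \<open>D ** R\<close>, an inverse of the block with unit
  \<open>D\<close>.\<close>

lemma block_inv_if_invertible:
  fixes A :: "real ^ 'd ^ 'd"
  assumes inv: "invertible (padded_block b A)"
  defines "B \<equiv> block b b (matrix_inv (padded_block b A))"
  shows "block b b B = B" "block b b A ** B = block b b (mat 1)" "B ** block b b A = block b b (mat 1)"
proof -
  define D D' where "D = block b b (mat 1 :: real ^ 'd ^ 'd)" and "D' = block (- b) (- b) (mat 1 :: real ^ 'd ^ 'd)"
  define Q R where "Q = padded_block b A" and "R = matrix_inv Q"
  have DD: "D ** D = D" "D ** D' = 0" "D' ** D = 0" and DDX: "D ** (D ** X) = D ** X" for X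
    by (simp_all add: D_def D'_def block_mat1_mult_block_mat1 matrix_mul_assoc)
  have blk: "block b b M = D ** (M ** D)" for M
    by (simp add: D_def block_eq_mult[of b b M] matrix_mul_assoc)
  have QR: "Q ** R = mat 1" "R ** Q = mat 1"
    using matrix_inv_mult[of Q] inv by (simp_all add: Q_def R_def)
  have Q: "Q = D ** (A ** D) + D'"
    by (simp add: Q_def padded_block_def blk D'_def)
  have QD: "block b b A = Q ** D" "block b b A = D ** Q"
    by (simp_all add: Q blk matrix_add_ldistrib matrix_add_rdistrib DD DDX flip: matrix_mul_assoc)
  have RD: "R ** D = D ** R"
  proof -
    have "R ** D = R ** D ** (Q ** R)" by (simp add: QR)
    also have "\<dots> = R ** (D ** Q) ** R" by (simp add: matrix_mul_assoc)
    also have "\<dots> = R ** (Q ** D) ** R" using QD by simp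
    also have "\<dots> = (R ** Q) ** D ** R" by (simp add: matrix_mul_assoc)
    finally show ?thesis by (simp add: QR)
  qed
  have B: "B = D ** R"
    unfolding B_def Q_def[symmetric] R_def[symmetric] by (simp add: blk RD DDX)
  show "block b b B = B"
    by (simp add: blk B DDX RD flip: matrix_mul_assoc)
  have "block b b A ** B = Q ** (D ** (D ** R))"
    by (simp add: QD(1) B matrix_mul_assoc)
  also have "\<dots> = (Q ** R) ** D"
    by (simp add: DDX RD flip: matrix_mul_assoc)
  finally show "block b b A ** B = block b b (mat 1)"
    by (simp add: QR D_def)
  have "B ** block b b A = D ** (R ** Q) ** D"
    by (simp add: QD(1) B matrix_mul_assoc)
  then show "B ** block b b A = block b b (mat 1)"
    by (simp add: QR DD D_def[symmetric])
qed

text \<open>\<open>B\<close> inverts the \<open>b\<close> block and \<open>D'\<close> the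
  complementary identity; the cross terms vanish because \<open>D ** D' = 0\<close>. For square
  matrices a right inverse suffices.\<close>

lemma invertible_padded_blockI:
  fixes A B :: "real ^ 'd ^ 'd"
  assumes "block b b B = B" "block b b A ** B = block b b (mat 1)"
  shows "invertible (padded_block b A)"
proof -
  define D D' where "D = block b b (mat 1 :: real ^ 'd ^ 'd)" and "D' = block (- b) (- b) (mat 1 :: real ^ 'd ^ 'd)"
  have DD: "D ** D = D" "D ** D' = 0" "D' ** D = 0" "D' ** D' = D'"
    by (simp_all add: D_def D'_def block_mat1_mult_block_mat1)
  have "block b b A ** D' = 0"
    unfolding block_eq_mult[of b b A] D_def[symmetric] by (simp add: DD matrix_mul_assoc[symmetric])
  moreover have "D' ** B = 0"
    by (subst assms(1)[symmetric], subst block_eq_mult) (simp add: DD matrix_mul_assoc flip: D_def)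
  ultimately have "padded_block b A ** (B + D') = D + D'"
    unfolding padded_block_def D'_def[symmetric]
    by (simp add: matrix_add_ldistrib matrix_add_rdistrib assms DD D_def)
  then have "padded_block b A ** (B + D') = mat 1"
    by (simp add: D_def D'_def block_mat1_add_compl)
  then show ?thesis
    using invertible_right_inverse by blast
qed

text \<open>
  The junk value of a singular block is one constant, which makes \<^const>\<open>block_inv\<close> measurable.
\<close>

lemma block_inv_eq:
  "block_inv b A = (if invertible (padded_block b A)
     then block b b (matrix_inv (padded_block b A)) else (SOME B. False))"
  for A :: "real ^ 'd ^ 'd"
proof (cases "invertible (padded_block b A)")
  case True
  then show ?thesis
    using block_inv_eqI[OF block_inv_if_invertible] by simp
next
  case False
  then have "(\<lambda>B. block b b B = B \<and> block b b A ** B = block b b (mat 1) \<and>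
      B ** block b b A = block b b (mat 1)) = (\<lambda>B. False)"
    using invertible_padded_blockI by blast
  then show ?thesis
    using False by (simp add: block_inv_def)
qed

text \<open>Column \<open>l\<close> of the inverse solves \<open>A *v x = axis l 1\<close>, so
  Cramer's rule gives each entry as a quotient of polynomials in the entries of \<open>A\<close>.
  Continuity of inversion is read off from this form.\<close>

lemma matrix_inv_cramer:
  fixes A :: "real ^ 'd ^ 'd"
  assumes "det A \<noteq> 0"
  shows "matrix_inv A = (\<chi> k l. det (\<chi> i j. if j = k then axis l 1 $ i else A $ i $ j) / det A)"
proof -
  have "matrix_inv A $ k $ l = det (\<chi> i j. if j = k then axis l 1 $ i else A $ i $ j) / det A" for k l
  proof -
    have "A *v (matrix_inv A *v axis l 1) = axis l 1"
      using assms by (simp add: matrix_vector_mul_assoc matrix_inv_mult invertible_det_nz)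
    then have "matrix_inv A *v axis l 1 = (\<chi> k. det (\<chi> i j. if j = k then axis l 1 $ i else A $ i $ j) / det A)"
      using cramer[OF assms] by blast
    moreover have "(matrix_inv A *v axis l 1) $ k = matrix_inv A $ k $ l"
      by (simp add: matrix_vector_mult_basis column_def)
    ultimately show ?thesis by simp
  qed
  then show ?thesis by (simp add: vec_eq_iff)
qed

section \<open>Continuity and measurability of matrix and block inversion\<close>

lemma continuous_on_if_const:
  "(P \<Longrightarrow> continuous_on S f) \<Longrightarrow> (\<not> P \<Longrightarrow> continuous_on S g) \<Longrightarrow>
    continuous_on S (\<lambda>x. if P then f x else g x)"
  by (cases P) simp_all

lemma continuous_on_det [continuous_intros]:
  fixes f :: "'a::topological_space \<Rightarrow> real ^ 'd ^ 'd"
  assumes "continuous_on S f"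
  shows "continuous_on S (\<lambda>x. det (f x))"
  unfolding det_def by (intro continuous_intros assms)

lemma open_invertible: "open {A :: real ^ 'd ^ 'd. invertible A}"
  unfolding invertible_det_nz
  by (intro open_Collect_neq continuous_intros)

lemma continuous_on_matrix_inv: "continuous_on {A :: real ^ 'd ^ 'd. invertible A} matrix_inv"
proof -
  have "continuous_on {A :: real ^ 'd ^ 'd. invertible A}
      (\<lambda>A. \<chi> k l. det (\<chi> i j. if j = k then axis l 1 $ i else A $ i $ j) / det A)"
    by (intro continuous_intros) (auto simp: invertible_det_nz intro!: continuous_on_if_const continuous_intros)
  then show ?thesis
    by (rule continuous_on_eq) (auto simp: invertible_det_nz matrix_inv_cramer)
qed

lemma continuous_on_block [continuous_intros]:
  assumes "continuous_on S f"
  shows "continuous_on S (\<lambda>x. block b b' (f x))"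
  unfolding block_def by (intro continuous_intros continuous_on_if_const assms)

lemma continuous_on_subvec [continuous_intros]:
  assumes "continuous_on S f"
  shows "continuous_on S (\<lambda>x. subvec b (f x))"
  unfolding subvec_def by (intro continuous_intros continuous_on_if_const assms)

lemma continuous_on_matrix_mult [continuous_intros]:
  fixes f :: "'a::topological_space \<Rightarrow> 'b::real_normed_algebra_1 ^ 'n ^ 'm"
  assumes "continuous_on S f" "continuous_on S g"
  shows "continuous_on S (\<lambda>x. f x ** g x)"
  unfolding matrix_matrix_mult_def by (intro continuous_intros assms)

lemma continuous_on_matrix_vector_mult [continuous_intros]:
  fixes f :: "'a::topological_space \<Rightarrow> 'b::real_normed_algebra_1 ^ 'n ^ 'm"
  assumes "continuous_on S f" "continuous_on S g"
  shows "continuous_on S (\<lambda>x. f x *v g x)"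
  unfolding matrix_vector_mult_def by (intro continuous_intros assms)

lemma continuous_on_block_inv:
  "continuous_on {A :: real ^ 'd ^ 'd. invertible (padded_block b A)} (block_inv b)"
proof -
  have "continuous_on {A :: real ^ 'd ^ 'd. invertible (padded_block b A)} (\<lambda>A. matrix_inv (padded_block b A))"
    by (rule continuous_on_compose2[OF continuous_on_matrix_inv])
       (auto simp: padded_block_def intro!: continuous_intros)
  then have "continuous_on {A :: real ^ 'd ^ 'd. invertible (padded_block b A)} (\<lambda>A. block b b (matrix_inv (padded_block b A)))"
    by (rule continuous_on_block)
  then show ?thesis
    by (rule continuous_on_eq) (simp add: block_inv_eq)
qed

lemma open_invertible_padded_block: "open {A :: real ^ 'd ^ 'd. invertible (padded_block b A)}"
  unfolding invertible_det_nz padded_block_def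
  by (intro open_Collect_neq continuous_intros)

text \<open>Estimated matrices may be singular for some outcomes, so measurability is needed on all
  matrices: the map is continuous on an open set and constant off it.\<close>

lemma borel_measurable_block_inv [measurable]:
  "block_inv b \<in> borel_measurable (borel :: (real ^ 'd ^ 'd) measure)"
proof -
  let ?S = "{A :: real ^ 'd ^ 'd. invertible (padded_block b A)}"
  have "(\<lambda>A. if A \<in> ?S then block_inv b A else (SOME B. False)) \<in> borel_measurable borel"
    by (intro borel_measurable_continuous_on_if continuous_on_block_inv borel_open open_invertible_padded_block continuous_intros)
  also have "(\<lambda>A. if A \<in> ?S then block_inv b A else (SOME B. False)) = block_inv b"
    by (auto simp: fun_eq_iff block_inv_eq)
  finally show ?thesis .
qed

lemma borel_measurable_matrix_inv [measurable]:
  "matrix_inv \<in> borel_measurable (borel :: (real ^ 'd ^ 'd) measure)"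
  using borel_measurable_block_inv[of UNIV] by (simp add: block_inv_UNIV[abs_def])

section \<open>Diagonal blocks of positive definite matrices\<close>

lemma inner_subvec: "subvec b x \<bullet> y = x \<bullet> subvec b y" for x y :: "real ^ 'd"
  by (auto simp: inner_vec_def subvec_def intro!: sum.cong)

lemma subvec_add_compl: "subvec b x + subvec (- b) x = x" for x :: "real ^ 'd"
  by (auto simp: vec_eq_iff subvec_def)

lemma subvec_subvec [simp]: "subvec b (subvec b' x) = subvec (b \<inter> b') x" for x :: "real ^ 'd"
  by (auto simp: vec_eq_iff subvec_def)

text \<open>The quadratic form of the padded block splits into that of \<open>A\<close> at
  \<open>subvec b x\<close> and the squared norm of \<open>subvec (- b) x\<close>. Both are
  nonnegative, so a kernel vector annihilates both and is zero.\<close>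

lemma invertible_padded_block_pos_def:
  fixes A :: "real ^ 'd ^ 'd"
  assumes pos: "\<And>x. x \<noteq> 0 \<Longrightarrow> x \<bullet> (A *v x) > 0"
  shows "invertible (padded_block b A)"
proof -
  have "x = 0" if x: "padded_block b A *v x = 0" for x
  proof -
    have "x \<bullet> (padded_block b A *v x) = subvec b x \<bullet> (A *v subvec b x) + subvec (- b) x \<bullet> subvec (- b) x"
      unfolding padded_block_def block_eq_mult[of b b A]
      by (simp add: matrix_vector_mult_add_rdistrib inner_add_right block_mat1_mult_vec inner_subvec
          flip: matrix_vector_mul_assoc)
    then have eq: "subvec b x \<bullet> (A *v subvec b x) + subvec (- b) x \<bullet> subvec (- b) x = 0"
      by (simp add: x)
    have "subvec b x \<bullet> (A *v subvec b x) \<ge> 0"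
      using pos[of "subvec b x"] by (cases "subvec b x = 0") auto
    with eq have "subvec (- b) x \<bullet> subvec (- b) x = 0"
      by (metis add_nonneg_eq_0_iff inner_ge_zero)
    with eq have "subvec b x = 0" "subvec (- b) x = 0"
      using pos[of "subvec b x"] by auto
    then show "x = 0"
      by (metis add.right_neutral subvec_add_compl)
  qed
  then have "\<exists>B. B ** padded_block b A = mat 1"
    by (simp add: matrix_left_invertible_ker)
  then show ?thesis
    by (simp add: invertible_left_inverse)
qed

section \<open>Convergence in distribution\<close>

text \<open>The integrands are close off the exceptional event and differ by at most
  \<open>2 * B\<close> on it, where the probability is small. The event may be chosen anew for each
  \<open>e\<close>.\<close>

lemma tendsto_integral_diff_0I:
  fixes f g :: "nat \<Rightarrow> 'a \<Rightarrow> real"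
  assumes "prob_space M"
    and meas: "\<And>n. f n \<in> borel_measurable M" "\<And>n. g n \<in> borel_measurable M"
    and bnd: "\<And>n \<omega>. \<bar>f n \<omega>\<bar> \<le> B" "\<And>n \<omega>. \<bar>g n \<omega>\<bar> \<le> B"
    and small: "\<And>e. e > 0 \<Longrightarrow> \<exists>E. (\<forall>n. E n \<in> sets M) \<and> (\<forall>\<^sub>F n in sequentially. measure M (E n) < e) \<and>
      (\<forall>\<^sub>F n in sequentially. \<forall>\<omega>\<in>space M - E n. \<bar>f n \<omega> - g n \<omega>\<bar> \<le> e)"
  shows "(\<lambda>n. (\<integral>\<omega>. f n \<omega> \<partial>M) - (\<integral>\<omega>. g n \<omega> \<partial>M)) \<longlonglongrightarrow> 0"
proof (rule tendstoI)
  interpret prob_space M by fact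
  fix e :: real assume e: "e > 0"
  have B: "B \<ge> 0" using bnd(1)[of 0 undefined] by linarith
  \<comment> \<open>Chosen so that \<open>(2 * B + 2) * d = e\<close>; the constant 2 in place of 1
    makes the final comparison with \<open>d + 2 * B * d\<close> strict.\<close>
  define d where "d = e / (2 * B + 2)"
  have d: "d > 0" using e B by (simp add: d_def)
  obtain E where E: "\<And>n. E n \<in> sets M" "\<forall>\<^sub>F n in sequentially. measure M (E n) < d"
    "\<forall>\<^sub>F n in sequentially. \<forall>\<omega>\<in>space M - E n. \<bar>f n \<omega> - g n \<omega>\<bar> \<le> d"
    using small[OF d] by blast
  have int: "integrable M (f n)" "integrable M (g n)" for n
    using bnd meas by (auto intro!: integrable_const_bound[of _ B])
  from E(2,3) show "\<forall>\<^sub>F n in sequentially. dist ((\<integral>\<omega>. f n \<omega> \<partial>M) - (\<integral>\<omega>. g n \<omega> \<partial>M)) 0 < e"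
  proof eventually_elim
    case (elim n)
    have intE: "integrable M (\<lambda>\<omega>. d + 2 * B * indicator (E n) \<omega>)"
      using E(1) by (auto intro!: integrable_add integrable_mult_right integrable_real_indicator simp: emeasure_eq_measure)
    have "\<bar>(\<integral>\<omega>. f n \<omega> \<partial>M) - (\<integral>\<omega>. g n \<omega> \<partial>M)\<bar> = \<bar>\<integral>\<omega>. f n \<omega> - g n \<omega> \<partial>M\<bar>"
      using int by simp
    also have "\<dots> \<le> (\<integral>\<omega>. \<bar>f n \<omega> - g n \<omega>\<bar> \<partial>M)"
      by (rule integral_abs_bound)
    also have "\<dots> \<le> (\<integral>\<omega>. d + 2 * B * indicator (E n) \<omega> \<partial>M)"
    proof (rule integral_mono)
      show "integrable M (\<lambda>\<omega>. \<bar>f n \<omega> - g n \<omega>\<bar>)" using int by simp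
      fix \<omega> assume "\<omega> \<in> space M"
      then show "\<bar>f n \<omega> - g n \<omega>\<bar> \<le> d + 2 * B * indicator (E n) \<omega>"
        using elim(2) bnd(1)[of n \<omega>] bnd(2)[of n \<omega>] d by (cases "\<omega> \<in> E n") auto
    qed (rule intE)
    also have "\<dots> = d + 2 * B * measure M (E n)"
      using E(1) by (subst Bochner_Integration.integral_add) (auto simp: prob_space emeasure_eq_measure intro!: integrable_real_indicator)
    also have "\<dots> \<le> d + 2 * B * d"
      using elim(1) B by (intro add_left_mono mult_left_mono) auto
    also have "\<dots> < (2 * B + 2) * d"
      using d by (simp add: algebra_simps)
    also have "\<dots> = e"
      using B by (simp add: d_def)
    finally show ?case by simp
  qed
qed

text \<open>The single limit variable has small tails by continuity of measure along a decreasing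
  sequence. Convergence for one continuous test function passes the tail bound on to
  \<open>X n\<close> for all large \<open>n\<close>.\<close>

lemma conv_in_distribution_tight:
  fixes X :: "nat \<Rightarrow> 'a \<Rightarrow> 'v::{real_normed_vector, second_countable_topology}"
  assumes "prob_space M" "prob_space N" and conv: "conv_in_distribution M X N Y" and e: "e > 0"
  obtains K where "K > 0" "\<forall>\<^sub>F n in sequentially. measure M {\<omega> \<in> space M. norm (X n \<omega>) > K} < e"
proof -
  interpret M: prob_space M by fact
  interpret N: prob_space N by fact
  have X [measurable]: "X n \<in> borel_measurable M" for n
    using conv by (simp add: conv_in_distribution_def)
  have Y [measurable]: "Y \<in> borel_measurable N"
    using conv by (simp add: conv_in_distribution_def)
  have "(\<lambda>k. measure N {\<omega> \<in> space N. norm (Y \<omega>) > real k}) \<longlonglongrightarrow> measure N (\<Inter>k. {\<omega> \<in> space N. norm (Y \<omega>) > real k})"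
    by (intro N.finite_Lim_measure_decseq) (auto simp: decseq_def)
  also have "(\<Inter>k. {\<omega> \<in> space N. norm (Y \<omega>) > real k}) = {}"
  proof -
    have "\<not> (\<forall>k. real k < norm y)" for y :: 'v
      by (meson less_asym reals_Archimedean2)
    then show ?thesis by auto
  qed
  finally have "\<forall>\<^sub>F k in sequentially. measure N {\<omega> \<in> space N. norm (Y \<omega>) > real k} < e"
    using e by (simp add: order_tendsto_iff)
  then obtain k where k: "measure N {\<omega> \<in> space N. norm (Y \<omega>) > real k} < e"
    by (auto simp: eventually_sequentially)
  \<comment> \<open>A continuous ramp between the indicators of \<open>norm v > real k + 1\<close>
    and \<open>norm v > real k\<close>; the upper comparison serves \<open>Y\<close>, the lower one
    \<open>X n\<close>.\<close>
  define g :: "'v \<Rightarrow> real" where "g v = max 0 (min 1 (norm v - real k))" for v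
  have g: "continuous_on UNIV g" "\<And>v. 0 \<le> g v" "\<And>v. g v \<le> 1"
    by (auto simp: g_def intro!: continuous_intros)
  have [measurable]: "g \<in> borel_measurable borel"
    by (rule borel_measurable_continuous_onI[OF g(1)])
  have "bounded (range g)"
    using g by (auto simp: bounded_iff intro!: exI[of _ 1])
  then have lim: "(\<lambda>n. \<integral>\<omega>. g (X n \<omega>) \<partial>M) \<longlonglongrightarrow> (\<integral>\<omega>. g (Y \<omega>) \<partial>N)"
    using conv g by (simp add: conv_in_distribution_def)
  have "(\<integral>\<omega>. g (Y \<omega>) \<partial>N) \<le> (\<integral>\<omega>. indicator {\<omega> \<in> space N. norm (Y \<omega>) > real k} \<omega> \<partial>N)"
    by (rule integral_mono)
       (auto simp: g_def indicator_def N.emeasure_eq_measure intro!: integrable_real_indicator N.integrable_const_bound[of _ 1])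
  also have "\<dots> < e"
    using k by (simp add: Int_def conj_commute)
  finally have "(\<integral>\<omega>. g (Y \<omega>) \<partial>N) < e" .
  then have ev: "\<forall>\<^sub>F n in sequentially. (\<integral>\<omega>. g (X n \<omega>) \<partial>M) < e"
    using lim by (simp add: order_tendsto_iff)
  have "measure M {\<omega> \<in> space M. norm (X n \<omega>) > real k + 1} \<le> (\<integral>\<omega>. g (X n \<omega>) \<partial>M)" for n
  proof -
    have "measure M {\<omega> \<in> space M. norm (X n \<omega>) > real k + 1} =
        (\<integral>\<omega>. indicator {\<omega> \<in> space M. norm (X n \<omega>) > real k + 1} \<omega> \<partial>M)"
      by (simp add: Int_def conj_commute)
    also have "\<dots> \<le> (\<integral>\<omega>. g (X n \<omega>) \<partial>M)"
      by (rule integral_mono)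
         (auto simp: g_def indicator_def M.emeasure_eq_measure intro!: integrable_real_indicator M.integrable_const_bound[of _ 1])
    finally show ?thesis .
  qed
  then have "\<forall>\<^sub>F n in sequentially. measure M {\<omega> \<in> space M. norm (X n \<omega>) > real k + 1} < e"
    using ev by (auto elim!: eventually_mono intro: le_less_trans)
  then show ?thesis
    by (intro that[of "real k + 1"]) auto
qed

section \<open>Continuous mapping and Slutsky's theorem\<close>

lemma conv_in_probability_eventually:
  assumes "conv_in_probability M X x" "d > 0" "e > 0"
  shows "\<forall>\<^sub>F n in sequentially. measure M {\<omega> \<in> space M. dist (X n \<omega>) x > d} < e"
  using assms unfolding conv_in_probability_def by (auto simp: order_tendsto_iff)

text \<open>Continuity at the limit point is enough, as \<open>X n\<close> is near it with high
  probability. This suits matrix inversion, which is continuous only where it is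
  nonsingular.\<close>

lemma conv_in_probability_isCont:
  fixes X :: "nat \<Rightarrow> 'a \<Rightarrow> 'v::{metric_space, second_countable_topology}" and G :: "'v \<Rightarrow> 'w::metric_space"
  assumes "prob_space M" and X [measurable]: "\<And>n. X n \<in> borel_measurable M"
    and conv: "conv_in_probability M X x" and G: "isCont G x"
  shows "conv_in_probability M (\<lambda>n \<omega>. G (X n \<omega>)) (G x)"
  unfolding conv_in_probability_def
proof (intro allI impI)
  interpret prob_space M by fact
  fix e :: real assume "e > 0"
  then obtain d where d: "d > 0" "\<And>y. dist y x < d \<Longrightarrow> dist (G y) (G x) < e"
    using G unfolding continuous_at_eps_delta by blast
  \<comment> \<open>Off the right-hand event the distance is at most \<open>d / 2\<close>, hence
    strictly below \<open>d\<close>.\<close>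
  have le: "measure M {\<omega> \<in> space M. dist (G (X n \<omega>)) (G x) > e} \<le> measure M {\<omega> \<in> space M. dist (X n \<omega>) x > d / 2}" for n
    using d by (intro finite_measure_mono) (auto, smt (verit) field_sum_of_halves)
  have lim: "(\<lambda>n. measure M {\<omega> \<in> space M. dist (X n \<omega>) x > d / 2}) \<longlonglongrightarrow> 0"
    by (rule conv[unfolded conv_in_probability_def, rule_format, OF half_gt_zero[OF d(1)]])
  show "(\<lambda>n. measure M {\<omega> \<in> space M. dist (G (X n \<omega>)) (G x) > e}) \<longlonglongrightarrow> 0"
    using le by (intro Lim_null_comparison[OF _ lim] always_eventually allI) (simp only: real_norm_def abs_of_nonneg measure_nonneg)
qed

text \<open>
  A bounded continuous \<open>f \<circ> h\<close> is uniformly continuous only on compact sets; tightness of the \<open>X n\<close>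
  makes this enough.
\<close>

lemma conv_in_distribution_slutsky:
  fixes X :: "nat \<Rightarrow> 'a \<Rightarrow> 'v::{real_normed_vector, heine_borel, second_countable_topology}"
    and W :: "nat \<Rightarrow> 'a \<Rightarrow> 'w::{heine_borel, second_countable_topology}"
    and h :: "'w \<times> 'v \<Rightarrow> 'u::topological_space"
  assumes M: "prob_space M" and N: "prob_space N"
    and X: "conv_in_distribution M X N Y"
    and W [measurable]: "\<And>n. W n \<in> borel_measurable M" and W_lim: "conv_in_probability M W w"
    and T [measurable]: "\<And>n. T n \<in> borel_measurable M"
    and h: "continuous_on UNIV h"
    and E [measurable]: "\<And>n. E n \<in> sets M" and E_lim: "(\<lambda>n. measure M (E n)) \<longlonglongrightarrow> 0"
    and T_eq: "\<And>n \<omega>. \<omega> \<in> space M \<Longrightarrow> \<omega> \<notin> E n \<Longrightarrow> T n \<omega> = h (W n \<omega>, X n \<omega>)"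
  shows "conv_in_distribution M T N (\<lambda>\<omega>. h (w, Y \<omega>))"
proof -
  interpret M: prob_space M by fact
  have [measurable]: "X n \<in> borel_measurable M" for n
    using X by (simp add: conv_in_distribution_def)
  have Y [measurable]: "Y \<in> borel_measurable N"
    using X by (simp add: conv_in_distribution_def)
  have hw: "continuous_on UNIV (\<lambda>x. h (w, x))"
    by (rule continuous_on_compose2[OF h]) (auto intro!: continuous_intros)
  have hw' [measurable]: "(\<lambda>x. h (w, x)) \<in> borel_measurable borel"
    by (rule borel_measurable_continuous_onI[OF hw])
  show ?thesis
    unfolding conv_in_distribution_def
  proof (intro conjI allI impI)
    show "(\<lambda>\<omega>. h (w, Y \<omega>)) \<in> borel_measurable N"
      by (rule measurable_compose[OF Y hw'])
    fix f :: "'u \<Rightarrow> real" assume f: "continuous_on UNIV f" and bnd: "bounded (range f)"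
    have f_meas [measurable]: "f \<in> borel_measurable borel"
      by (rule borel_measurable_continuous_onI[OF f])
    have fh: "continuous_on UNIV (\<lambda>p. f (h p))"
      by (rule continuous_on_compose2[OF f h]) auto
    have fhw: "continuous_on UNIV (\<lambda>x. f (h (w, x)))"
      by (rule continuous_on_compose2[OF f hw]) auto
    obtain B where B: "\<And>u. \<bar>f u\<bar> \<le> B"
      using bnd by (auto simp: bounded_iff)
    \<comment> \<open>Freezing the first argument at \<open>w\<close> leaves a continuous function
      of \<open>X n\<close> alone, to which the assumed convergence applies. It remains to show that
      freezing costs nothing in the limit.\<close>
    have "bounded (range (\<lambda>x. f (h (w, x))))"
      using B by (auto simp: bounded_iff)
    then have lim: "(\<lambda>n. \<integral>\<omega>. f (h (w, X n \<omega>)) \<partial>M) \<longlonglongrightarrow> (\<integral>\<omega>. f (h (w, Y \<omega>)) \<partial>N)"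
      by (rule X[unfolded conv_in_distribution_def, THEN conjunct2, THEN conjunct2, rule_format, OF fhw])
    have "(\<lambda>n. (\<integral>\<omega>. f (T n \<omega>) \<partial>M) - (\<integral>\<omega>. f (h (w, X n \<omega>)) \<partial>M)) \<longlonglongrightarrow> 0"
    proof (rule tendsto_integral_diff_0I[OF M, where B = B])
      show "(\<lambda>\<omega>. f (T n \<omega>)) \<in> borel_measurable M" for n by measurable
      show "(\<lambda>\<omega>. f (h (w, X n \<omega>))) \<in> borel_measurable M" for n
        by (rule measurable_compose[OF _ borel_measurable_continuous_onI[OF fhw]]) measurable
      fix e :: real assume e: "e > 0"
      then have e3: "e / 3 > 0" by simp
      obtain K where K: "K > 0" "\<forall>\<^sub>F n in sequentially. measure M {\<omega> \<in> space M. norm (X n \<omega>) > K} < e / 3"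
        using conv_in_distribution_tight[OF M N X e3] .
      have "uniformly_continuous_on (cball w 1 \<times> cball 0 K) (\<lambda>p. f (h p))"
        by (intro compact_uniformly_continuous continuous_on_subset[OF fh] compact_Times) auto
      then obtain d where d: "d > 0" "\<And>p q. p \<in> cball w 1 \<times> cball 0 K \<Longrightarrow> q \<in> cball w 1 \<times> cball 0 K \<Longrightarrow>
          dist q p < d \<Longrightarrow> dist (f (h q)) (f (h p)) < e"
        unfolding uniformly_continuous_on_def using e by blast
      \<comment> \<open>The bound 1 keeps \<open>W n\<close> in the compact ball around
        \<open>w\<close>; the bound \<open>d / 2\<close> meets the strict hypothesis of uniform
        continuity.\<close>
      define d' where "d' = min 1 (d / 2)"
      have d': "d' > 0" "d' < d" "d' \<le> 1" using d(1) by (auto simp: d'_def)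
      \<comment> \<open>Off \<open>F n\<close> both arguments lie in the compact product and
        \<open>T n\<close> is given by \<open>h\<close>. Each of the three events eventually has
        probability below \<open>e / 3\<close>.\<close>
      define F where "F n = E n \<union> {\<omega> \<in> space M. norm (X n \<omega>) > K} \<union> {\<omega> \<in> space M. dist (W n \<omega>) w > d'}" for n
      have "\<forall>n. F n \<in> sets M"
        unfolding F_def by measurable
      moreover have "\<forall>\<^sub>F n in sequentially. measure M (E n) < e / 3"
        by (rule order_tendstoD(2)[OF E_lim e3])
      then have "\<forall>\<^sub>F n in sequentially. measure M (F n) < e"
        using K(2) conv_in_probability_eventually[OF W_lim d'(1) e3]
      proof eventually_elim
        case (elim n)
        have "measure M (F n) \<le> measure M (E n \<union> {\<omega> \<in> space M. norm (X n \<omega>) > K}) + measure M {\<omega> \<in> space M. dist (W n \<omega>) w > d'}"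
          unfolding F_def by (rule measure_Un_le) measurable
        also have "measure M (E n \<union> {\<omega> \<in> space M. norm (X n \<omega>) > K}) \<le>
            measure M (E n) + measure M {\<omega> \<in> space M. norm (X n \<omega>) > K}"
          by (rule measure_Un_le) measurable
        finally show ?case using elim by simp
      qed
      moreover have "\<forall>\<omega>\<in>space M - F n. \<bar>f (T n \<omega>) - f (h (w, X n \<omega>))\<bar> \<le> e" for n
      proof
        fix \<omega> assume \<omega>: "\<omega> \<in> space M - F n"
        have "dist (f (h (W n \<omega>, X n \<omega>))) (f (h (w, X n \<omega>))) < e"
          using \<omega> K(1) d' by (intro d(2)) (auto simp: F_def dist_Pair_Pair dist_commute)
        then show "\<bar>f (T n \<omega>) - f (h (w, X n \<omega>))\<bar> \<le> e"
          using \<omega> T_eq[of \<omega> n] by (simp add: F_def dist_real_def)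
      qed
      ultimately show "\<exists>E. (\<forall>n. E n \<in> sets M) \<and> (\<forall>\<^sub>F n in sequentially. measure M (E n) < e) \<and>
          (\<forall>\<^sub>F n in sequentially. \<forall>\<omega>\<in>space M - E n. \<bar>f (T n \<omega>) - f (h (w, X n \<omega>))\<bar> \<le> e)"
        by (intro exI[of _ F]) simp
    qed (use B in auto)
    from tendsto_add[OF this lim] show "(\<lambda>n. \<integral>\<omega>. f (T n \<omega>) \<partial>M) \<longlonglongrightarrow> (\<integral>\<omega>. f (h (w, Y \<omega>)) \<partial>N)"
      by simp
  qed measurable
qed

section \<open>Positive definiteness of the precision matrix\<close>

lemma borel_measurable_vec_component [measurable (raw)]:
  fixes f :: "'a \<Rightarrow> 'b::{second_countable_topology, real_normed_vector} ^ 'd"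
  shows "f \<in> borel_measurable M \<Longrightarrow> (\<lambda>x. f x $ i) \<in> borel_measurable M"
  by (rule borel_measurable_continuous_on) (intro continuous_intros)

text \<open>With mean zero, covariances are plain second moments, and the rest is expansion of the
  inner product. The component formula shows that the matrix annihilates \<open>y\<close> once
  \<open>y \<bullet> Z \<omega>\<close> vanishes almost surely.\<close>

lemma covariance_matrix_inner:
  fixes Z :: "'b \<Rightarrow> real ^ 'd"
  assumes "prob_space Q" and Z [measurable]: "Z \<in> borel_measurable Q"
    and sq: "integrable Q (\<lambda>\<omega>. (norm (Z \<omega>))\<^sup>2)" and mean: "(\<integral>\<omega>. Z \<omega> \<partial>Q) = 0"
  shows "(covariance_matrix Q Z *v y) $ i = (\<integral>\<omega>. Z \<omega> $ i * (y \<bullet> Z \<omega>) \<partial>Q)"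
    and "integrable Q (\<lambda>\<omega>. (y \<bullet> Z \<omega>)\<^sup>2)"
    and "y \<bullet> (covariance_matrix Q Z *v y) = (\<integral>\<omega>. (y \<bullet> Z \<omega>)\<^sup>2 \<partial>Q)"
proof -
  interpret prob_space Q by fact
  have int: "integrable Q (\<lambda>\<omega>. Z \<omega> $ i * Z \<omega> $ j)" for i j
  proof (rule Bochner_Integration.integrable_bound[OF sq])
    show "AE \<omega> in Q. norm (Z \<omega> $ i * Z \<omega> $ j) \<le> norm ((norm (Z \<omega>))\<^sup>2)"
      by (auto simp: abs_mult power2_eq_square intro!: mult_mono component_le_norm_cart)
  qed measurable
  \<comment> \<open>Integrability of \<open>Z\<close> itself lets the vanishing mean be read
    componentwise.\<close>
  have intZ: "integrable Q Z"
  proof (rule Bochner_Integration.integrable_bound)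
    show "integrable Q (\<lambda>\<omega>. 1 + (norm (Z \<omega>))\<^sup>2)" using sq by simp
    have "norm z \<le> 1 + (norm z)\<^sup>2" for z :: "real ^ 'd"
      using zero_le_power2[of "norm z - 1"] by (simp add: power2_diff) (smt (verit) norm_ge_zero)
    then show "AE \<omega> in Q. norm (Z \<omega>) \<le> norm (1 + (norm (Z \<omega>))\<^sup>2)" by auto
  qed measurable
  have "(\<integral>\<omega>. Z \<omega> $ i \<partial>Q) = (\<integral>\<omega>. Z \<omega> \<partial>Q) $ i" for i
    using integral_bounded_linear[OF bounded_linear_vec_nth intZ] by simp
  then have cov: "covariance_matrix Q Z $ i $ j = (\<integral>\<omega>. Z \<omega> $ i * Z \<omega> $ j \<partial>Q)" for i j
    by (simp add: covariance_matrix_def mean)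
  have expand: "Z \<omega> $ i * (y \<bullet> Z \<omega>) = (\<Sum>j\<in>UNIV. Z \<omega> $ i * Z \<omega> $ j * y $ j)" for \<omega> i
    by (simp add: inner_vec_def sum_distrib_left ac_simps)
  have int1: "integrable Q (\<lambda>\<omega>. Z \<omega> $ i * (y \<bullet> Z \<omega>))" for i
    unfolding expand by (intro Bochner_Integration.integrable_sum integrable_mult_left int)
  show comp: "(covariance_matrix Q Z *v y) $ i = (\<integral>\<omega>. Z \<omega> $ i * (y \<bullet> Z \<omega>) \<partial>Q)" for i
    unfolding expand using int by (simp add: matrix_vector_mult_def cov)
  have sq_eq: "(y \<bullet> Z \<omega>)\<^sup>2 = (\<Sum>i\<in>UNIV. y $ i * (Z \<omega> $ i * (y \<bullet> Z \<omega>)))" for \<omega>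
  proof -
    have "(y \<bullet> Z \<omega>)\<^sup>2 = (\<Sum>i\<in>UNIV. y $ i * Z \<omega> $ i) * (y \<bullet> Z \<omega>)"
      by (simp add: power2_eq_square inner_vec_def)
    then show ?thesis by (simp add: sum_distrib_right mult.assoc)
  qed
  show "integrable Q (\<lambda>\<omega>. (y \<bullet> Z \<omega>)\<^sup>2)"
    unfolding sq_eq by (intro Bochner_Integration.integrable_sum integrable_mult_right int1)
  show "y \<bullet> (covariance_matrix Q Z *v y) = (\<integral>\<omega>. (y \<bullet> Z \<omega>)\<^sup>2 \<partial>Q)"
    unfolding sq_eq using int1 by (simp add: inner_vec_def[of y "_ *v _"] comp)
qed

text \<open>For \<open>y = V *v x\<close>, the covariance matrix maps \<open>y\<close> back to
  \<open>x\<close>, and the quadratic form of \<open>V\<close> at \<open>x\<close> is the second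
  moment of \<open>y \<bullet> Z \<omega>\<close>. If that were zero, the covariance matrix would
  annihilate \<open>y\<close>, forcing \<open>x = 0\<close>.\<close>

lemma precision_matrix_pos_def:
  fixes Z :: "'b \<Rightarrow> real ^ 'd"
  assumes Q: "prob_space Q" "Z \<in> borel_measurable Q" "integrable Q (\<lambda>\<omega>. (norm (Z \<omega>))\<^sup>2)" "(\<integral>\<omega>. Z \<omega> \<partial>Q) = 0"
    and inv: "invertible V" and cov: "covariance_matrix Q Z = matrix_inv V" and "x \<noteq> 0"
  shows "x \<bullet> (V *v x) > 0"
proof -
  note [measurable] = Q(2)
  define y where "y = V *v x"
  have x: "x = covariance_matrix Q Z *v y"
    using inv by (simp add: y_def cov matrix_vector_mul_assoc matrix_inv_mult)
  note C = covariance_matrix_inner[OF Q, where y = y]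
  have eq: "x \<bullet> (V *v x) = (\<integral>\<omega>. (y \<bullet> Z \<omega>)\<^sup>2 \<partial>Q)"
    using C(3) unfolding x[symmetric] by (simp add: y_def inner_commute)
  have "(\<integral>\<omega>. (y \<bullet> Z \<omega>)\<^sup>2 \<partial>Q) \<noteq> 0"
  proof
    assume "(\<integral>\<omega>. (y \<bullet> Z \<omega>)\<^sup>2 \<partial>Q) = 0"
    then have "AE \<omega> in Q. (y \<bullet> Z \<omega>)\<^sup>2 = 0"
      using C(2) by (subst (asm) integral_nonneg_eq_0_iff_AE) auto
    then have "AE \<omega> in Q. Z \<omega> $ i * (y \<bullet> Z \<omega>) = 0" for i
      by eventually_elim simp
    then have "x $ i = 0" for i
      by (subst x) (simp add: C(1) integral_eq_zero_AE)
    with \<open>x \<noteq> 0\<close> show False by (simp add: vec_eq_iff)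
  qed
  then show ?thesis
    unfolding eq by (simp add: less_le)
qed

section \<open>The oracle Hodges estimator\<close>

lemma borel_measurable_vec_iff:
  fixes f :: "'a \<Rightarrow> real ^ 'd"
  shows "f \<in> borel_measurable M \<longleftrightarrow> (\<forall>i. (\<lambda>x. f x $ i) \<in> borel_measurable M)"
  by (subst borel_measurable_euclidean_space) (auto simp: Basis_vec_def inner_axis)

lemma measurable_selected [measurable (raw)]:
  fixes t :: "'a \<Rightarrow> real ^ 'd"
  assumes [measurable]: "t \<in> borel_measurable M"
  shows "(\<lambda>\<omega>. selected c a (t \<omega>)) \<in> measurable M (count_space UNIV)"
proof -
  have "(\<lambda>\<omega>. selected c a (t \<omega>)) -` {b} \<inter> space M =
      {\<omega> \<in> space M. \<forall>j. (\<bar>t \<omega> $ j - c $ j\<bar> > a $ j) = (j \<in> b)}" for b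
    by (auto simp: selected_def)
  moreover have "{\<omega> \<in> space M. \<forall>j. (\<bar>t \<omega> $ j - c $ j\<bar> > a $ j) = (j \<in> b)} \<in> sets M" for b
    by measurable
  ultimately show ?thesis
    by (subst measurable_count_space_eq2) auto
qed

lemma borel_measurable_restricted_estimate [measurable (raw)]:
  fixes t :: "'a \<Rightarrow> real ^ 'd"
  assumes [measurable]: "t \<in> borel_measurable M" "V \<in> borel_measurable M"
  shows "(\<lambda>\<omega>. restricted_estimate c b (V \<omega>) (t \<omega>)) \<in> borel_measurable M"
proof -
  \<comment> \<open>The value of \<open>block_inv\<close> becomes a separate argument because the
    remaining expression is jointly continuous, while \<open>block_inv\<close> is merely measurable
    on all matrices.\<close>
  have "(\<lambda>\<omega>. (block_inv b (V \<omega>), V \<omega>, t \<omega>)) \<in> borel_measurable M"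
    by measurable
  then have "(\<lambda>\<omega>. (\<lambda>(B, A, x). subvec b x + (B ** block b (- b) A) *v subvec (- b) (x - c))
      (block_inv b (V \<omega>), V \<omega>, t \<omega>)) \<in> borel_measurable M"
    by (rule borel_measurable_continuous_on[rotated]) (auto simp: split_beta intro!: continuous_intros)
  then show ?thesis
    by (simp add: restricted_estimate_def)
qed

text \<open>
  The cases \<open>b = UNIV\<close> and \<open>b = {}\<close> of the definition are not exceptional: there the block
  multiplying \<^const>\<open>block_inv\<close> is zero or the result is not used.
\<close>

lemma oracle_hodges_eq:
  "oracle_hodges c a V t =
    (\<chi> j. if j \<in> selected c a t then restricted_estimate c (selected c a t) V t $ j else c $ j)"
  by (auto simp: oracle_hodges_def Let_def vec_eq_iff restricted_estimate_def subvec_def)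

lemma borel_measurable_oracle_hodges [measurable (raw)]:
  fixes t :: "'a \<Rightarrow> real ^ 'd"
  assumes [measurable]: "t \<in> borel_measurable M" "V \<in> borel_measurable M"
  shows "(\<lambda>\<omega>. oracle_hodges c a (V \<omega>) (t \<omega>)) \<in> borel_measurable M"
proof -
  have "(\<lambda>\<omega>. if j \<in> b then restricted_estimate c b (V \<omega>) (t \<omega>) $ j else c $ j) \<in> borel_measurable M" for j b
    by measurable
  \<comment> \<open>The index set is held fixed first and the random selection substituted
    afterwards; there are only finitely many index sets.\<close>
  then have "(\<lambda>\<omega>. (\<lambda>b \<omega>. if j \<in> b then restricted_estimate c b (V \<omega>) (t \<omega>) $ j else c $ j) (selected c a (t \<omega>)) \<omega>)
      \<in> borel_measurable M" for j
    by (rule measurable_compose_countable) measurable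
  then show ?thesis
    by (subst borel_measurable_vec_iff) (simp add: oracle_hodges_eq)
qed

text \<open>The matrix taking the initial error to the error of the restricted estimate on
  \<open>b\<close> when the truth agrees with \<open>c\<close> outside \<open>b\<close>. Writing the
  identity on \<open>b\<close> instead of \<open>block_inv b V ** block b b V\<close> keeps the
  error formula valid for singular \<open>V\<close>.\<close>

definition restricted_coeff :: "'d set \<Rightarrow> real ^ 'd ^ 'd \<Rightarrow> real ^ 'd ^ 'd" where
  "restricted_coeff b V = block b b (mat 1) + block_inv b V ** block b (- b) V"

lemma borel_measurable_restricted_coeff [measurable (raw)]:
  fixes V :: "'a \<Rightarrow> real ^ 'd ^ 'd"
  assumes [measurable]: "V \<in> borel_measurable M"
  shows "(\<lambda>\<omega>. restricted_coeff b (V \<omega>)) \<in> borel_measurable M"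
proof -
  have "(\<lambda>\<omega>. (block_inv b (V \<omega>), V \<omega>)) \<in> borel_measurable M"
    by measurable
  then have "(\<lambda>\<omega>. (\<lambda>(B, A). block b b (mat 1) + B ** block b (- b) A) (block_inv b (V \<omega>), V \<omega>))
      \<in> borel_measurable M"
    by (rule borel_measurable_continuous_on[rotated]) (auto simp: split_beta intro!: continuous_intros)
  then show ?thesis
    by (simp add: restricted_coeff_def)
qed

section \<open>The normalized error under correct selection\<close>

lemma block_mult_subvec: "block b b' A *v subvec b' x = block b b' A *v x" for A :: "real ^ 'd ^ 'd"
  unfolding block_eq_mult[of b b' A]
  by (simp add: block_mat1_mult_vec flip: matrix_vector_mul_assoc)

text \<open>Outside \<open>b\<close> the vectors \<open>c\<close> and \<open>\<theta>\<close> agree,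
  so \<open>\<theta>\<close> may replace \<open>c\<close> in the correction term and the error
  becomes linear in \<open>t - \<theta>\<close>. The outer \<open>subvec b\<close> removes whatever
  the default value of \<open>block_inv\<close> might put outside \<open>b\<close>.\<close>

lemma scaled_oracle_hodges_error:
  fixes \<theta> c :: "real ^ 'd"
  assumes sel: "selected c a t = {j. \<theta> $ j \<noteq> c $ j}"
  defines "b \<equiv> {j. \<theta> $ j \<noteq> c $ j}"
  shows "r *\<^sub>R (oracle_hodges c a V t - \<theta>) = subvec b (restricted_coeff b V *v (r *\<^sub>R (t - \<theta>)))"
proof -
  have "subvec (- b) (t - c) = subvec (- b) (t - \<theta>)"
    by (auto simp: vec_eq_iff subvec_def b_def)
  then have "restricted_estimate c b V t = subvec b t + (block_inv b V ** block b (- b) V) *v (t - \<theta>)"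
    by (simp add: restricted_estimate_def block_mult_subvec flip: matrix_vector_mul_assoc)
  then have "subvec b (restricted_estimate c b V t - \<theta>) = subvec b (restricted_coeff b V *v (t - \<theta>))"
    by (simp add: restricted_coeff_def matrix_vector_mult_add_rdistrib block_mat1_mult_vec)
       (simp add: vec_eq_iff subvec_def)
  moreover have "oracle_hodges c a V t - \<theta> = subvec b (restricted_estimate c b V t - \<theta>)"
    unfolding oracle_hodges_eq sel b_def[symmetric] by (auto simp: vec_eq_iff subvec_def b_def)
  moreover have "subvec b (r *\<^sub>R x) = r *\<^sub>R subvec b x" for x
    by (simp add: vec_eq_iff subvec_def)
  ultimately show ?thesis
    by (simp add: matrix_vector_mult_scaleR)
qed

text \<open>Splitting the block row into its \<open>b\<close> and \<open>- b\<close> columns, the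
  inverse cancels the \<open>b\<close> part to the identity. For empty \<open>b\<close> both sides
  are zero.\<close>

lemma Z_check_eq_restricted_coeff:
  assumes "invertible (padded_block b V)"
  shows "Z_check b V z = restricted_coeff b V *v z"
proof (cases "b = {}")
  case False
  have "block_inv b V ** block b b V = block b b (mat 1)"
    using block_inv_if_invertible(3)[OF assms] assms by (simp add: block_inv_eq)
  with False show ?thesis
    unfolding Z_check_def restricted_coeff_def block_add_compl[of b b V, symmetric]
    by (simp add: matrix_add_ldistrib)
qed (simp add: Z_check_def restricted_coeff_def)

section \<open>Continuity of the coefficient matrix and correct selection\<close>

lemma matrix_inv_involutory:
  fixes V :: "'a::field ^ 'd ^ 'd"
  assumes "invertible V"
  shows "invertible (matrix_inv V)" "matrix_inv (matrix_inv V) = V"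
proof -
  show inv: "invertible (matrix_inv V)"
    using matrix_inv_mult[OF assms] unfolding invertible_def by blast
  have "matrix_inv (matrix_inv V) = matrix_inv (matrix_inv V) ** (matrix_inv V ** V)"
    by (simp add: matrix_inv_mult assms)
  also have "\<dots> = V"
    by (simp add: matrix_mul_assoc matrix_inv_mult inv)
  finally show "matrix_inv (matrix_inv V) = V" .
qed

text \<open>Consistency is assumed for the estimator of the inverse of \<open>V\<close>, so
  continuity is needed at \<open>matrix_inv V\<close> for the composite that inverts first.\<close>

lemma isCont_restricted_coeff_matrix_inv:
  fixes V :: "real ^ 'd ^ 'd"
  assumes "invertible V" "invertible (padded_block b V)"
  shows "isCont (\<lambda>A. restricted_coeff b (matrix_inv A)) (matrix_inv V)"
proof -
  have "continuous_on {A. invertible (padded_block b A)} (restricted_coeff b)"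
    unfolding restricted_coeff_def by (intro continuous_intros continuous_on_block_inv)
  then have "isCont (restricted_coeff b) (matrix_inv (matrix_inv V))"
    using assms by (simp add: continuous_on_eq_continuous_at open_invertible_padded_block matrix_inv_involutory)
  moreover have "isCont matrix_inv (matrix_inv V)"
    using continuous_on_matrix_inv[where 'd = 'd] matrix_inv_involutory(1)[OF assms(1)]
    by (simp add: continuous_on_eq_continuous_at open_invertible)
  ultimately show ?thesis
    by (rule isCont_o2[where f = matrix_inv and g = "restricted_coeff b", rotated])
qed

text \<open>The bound \<open>K\<close> confines each coordinate error to \<open>K / r n\<close>,
  which the threshold eventually exceeds if \<open>\<theta> $ j = c $ j\<close>. Uniformity in
  \<open>t\<close> permits use outcome by outcome.\<close>

lemma eventually_selected_eq:
  fixes c \<theta> :: "real ^ 'd" and a :: "nat \<Rightarrow> real ^ 'd"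
  assumes r: "filterlim r at_top sequentially"
    and a_max: "(\<lambda>n. MAX j. a n $ j) \<longlonglongrightarrow> 0"
    and a_min: "filterlim (\<lambda>n. r n * (MIN j. a n $ j)) at_top sequentially"
  shows "\<forall>\<^sub>F n in sequentially. \<forall>t. norm (r n *\<^sub>R (t - \<theta>)) \<le> K \<longrightarrow> selected c (a n) t = {j. \<theta> $ j \<noteq> c $ j}"
proof -
  have comp: "r n * \<bar>t $ j - \<theta> $ j\<bar> \<le> K" if "norm (r n *\<^sub>R (t - \<theta>)) \<le> K" "r n > 0" for n t j
  proof -
    have "r n * \<bar>t $ j - \<theta> $ j\<bar> = \<bar>(r n *\<^sub>R (t - \<theta>)) $ j\<bar>"
      using that(2) by (simp add: abs_mult)
    also have "\<dots> \<le> K"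
      using component_le_norm_cart that(1) by (rule order_trans)
    finally show ?thesis .
  qed
  have r_pos: "\<forall>\<^sub>F n in sequentially. r n > 0"
    using r by (simp add: filterlim_at_top_dense)
  have "\<forall>\<^sub>F n in sequentially. \<forall>t. norm (r n *\<^sub>R (t - \<theta>)) \<le> K \<longrightarrow> (j \<in> selected c (a n) t \<longleftrightarrow> \<theta> $ j \<noteq> c $ j)" for j
  proof (cases "\<theta> $ j = c $ j")
    case True
    have "\<forall>\<^sub>F n in sequentially. r n * (MIN j. a n $ j) > K"
      using a_min by (simp add: filterlim_at_top_dense)
    with r_pos show ?thesis
    proof eventually_elim
      case (elim n)
      have "(MIN j. a n $ j) \<le> a n $ j" by simp
      then have "K < r n * a n $ j"
        using elim by (smt (verit) mult_left_mono)
      then have "\<bar>t $ j - c $ j\<bar> \<le> a n $ j" if "norm (r n *\<^sub>R (t - \<theta>)) \<le> K" for t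
        using comp[OF that elim(1), of j] elim(1) True by (smt (verit) mult_left_le_imp_le)
      with True show ?case by (auto simp: selected_def not_less)
    qed
  next
    case False
    \<comment> \<open>Half of the gap \<open>d\<close> absorbs the coordinate error and the other
      half exceeds the threshold, so \<open>j\<close> is selected.\<close>
    define d where "d = \<bar>\<theta> $ j - c $ j\<bar>"
    have d: "d > 0" using False by (simp add: d_def)
    have "\<forall>\<^sub>F n in sequentially. r n > 2 * K / d"
      using r by (simp add: filterlim_at_top_dense)
    moreover have "\<forall>\<^sub>F n in sequentially. (MAX j. a n $ j) < d / 2"
      by (rule order_tendstoD(2)[OF a_max]) (use d in simp)
    ultimately show ?thesis
      using r_pos
    proof eventually_elim
      case (elim n)
      have "a n $ j \<le> (MAX j. a n $ j)" by simp
      then have a: "a n $ j < d / 2" using elim(2) by (rule le_less_trans)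
      have K: "K < r n * (d / 2)" using elim(1) d by (simp add: field_simps)
      have "\<bar>t $ j - c $ j\<bar> > a n $ j" if "norm (r n *\<^sub>R (t - \<theta>)) \<le> K" for t
      proof -
        have "\<bar>t $ j - \<theta> $ j\<bar> < d / 2"
          using comp[OF that elim(3), of j] K elim(3) by (smt (verit) mult_left_le_imp_le)
        moreover have "d \<le> \<bar>t $ j - \<theta> $ j\<bar> + \<bar>t $ j - c $ j\<bar>"
          unfolding d_def by arith
        ultimately show ?thesis using a by linarith
      qed
      with False show ?case by (simp add: selected_def)
    qed
  qed
  then have "\<forall>\<^sub>F n in sequentially. \<forall>j. \<forall>t. norm (r n *\<^sub>R (t - \<theta>)) \<le> K \<longrightarrow> (j \<in> selected c (a n) t \<longleftrightarrow> \<theta> $ j \<noteq> c $ j)"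
    by (rule eventually_all_finite)
  then show ?thesis
    by eventually_elim blast
qed

theorem theorem2p2:
  fixes \<Theta> :: "(real ^ 'd) set"
    and P :: "real ^ 'd \<Rightarrow> 'a measure"
    and \<theta>hat :: "nat \<Rightarrow> 'a \<Rightarrow> real ^ 'd"
    and Q :: "real ^ 'd \<Rightarrow> 'b measure"
    and Z :: "real ^ 'd \<Rightarrow> 'b \<Rightarrow> real ^ 'd"
    and V :: "real ^ 'd \<Rightarrow> real ^ 'd ^ 'd"
    and Vinv_hat :: "nat \<Rightarrow> 'a \<Rightarrow> real ^ 'd ^ 'd"
    and r :: "nat \<Rightarrow> real"
    and c :: "real ^ 'd"
    and a :: "nat \<Rightarrow> real ^ 'd"
    and \<theta>tilde :: "nat \<Rightarrow> 'a \<Rightarrow> real ^ 'd"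
  assumes prob_P: "\<And>\<theta>. \<theta> \<in> \<Theta> \<Longrightarrow> prob_space (P \<theta>)"
    and meas_\<theta>hat: "\<And>\<theta> n. \<theta> \<in> \<Theta> \<Longrightarrow> \<theta>hat n \<in> borel_measurable (P \<theta>)"
    and prob_Q: "\<And>\<theta>. \<theta> \<in> \<Theta> \<Longrightarrow> prob_space (Q \<theta>)"
    and meas_Z: "\<And>\<theta>. \<theta> \<in> \<Theta> \<Longrightarrow> Z \<theta> \<in> borel_measurable (Q \<theta>)"
    and sq_int_Z: "\<And>\<theta>. \<theta> \<in> \<Theta> \<Longrightarrow> integrable (Q \<theta>) (\<lambda>\<omega>. (norm (Z \<theta> \<omega>))\<^sup>2)"
    and mean_Z: "\<And>\<theta>. \<theta> \<in> \<Theta> \<Longrightarrow> (\<integral>\<omega>. Z \<theta> \<omega> \<partial>Q \<theta>) = 0"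
    and inv_V: "\<And>\<theta>. \<theta> \<in> \<Theta> \<Longrightarrow> invertible (V \<theta>)"
    and cov_Z: "\<And>\<theta>. \<theta> \<in> \<Theta> \<Longrightarrow> covariance_matrix (Q \<theta>) (Z \<theta>) = matrix_inv (V \<theta>)"
    and cont_Vinv: "continuous_on \<Theta> (\<lambda>\<theta>. matrix_inv (V \<theta>))"
    and r_lim: "filterlim r at_top sequentially"
    and conv_\<theta>hat: "\<And>\<theta>. \<theta> \<in> \<Theta> \<Longrightarrow>
      conv_in_distribution (P \<theta>) (\<lambda>n \<omega>. r n *\<^sub>R (\<theta>hat n \<omega> - \<theta>)) (Q \<theta>) (Z \<theta>)"
    and meas_Vinv_hat: "\<And>\<theta> n. \<theta> \<in> \<Theta> \<Longrightarrow> Vinv_hat n \<in> borel_measurable (P \<theta>)"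
    and consistent_Vinv_hat: "\<And>\<theta>. \<theta> \<in> \<Theta> \<Longrightarrow>
      conv_in_probability (P \<theta>) Vinv_hat (matrix_inv (V \<theta>))"
    and a_pos: "\<And>n j. a n $ j > 0"
    and a_max: "(\<lambda>n. MAX j. a n $ j) \<longlonglongrightarrow> 0"
    and a_min: "filterlim (\<lambda>n. r n * (MIN j. a n $ j)) at_top sequentially"
    and \<theta>tilde: "\<And>n \<omega>.
      \<theta>tilde n \<omega> = oracle_hodges c (a n) (matrix_inv (Vinv_hat n \<omega>)) (\<theta>hat n \<omega>)"
  shows "\<forall>\<theta>\<in>\<Theta>.
      (\<forall>b. subvec (- b) \<theta> = subvec (- b) c \<longrightarrow>
        (\<lambda>n. measure (P \<theta>) {\<omega> \<in> space (P \<theta>). subvec (- b) (\<theta>tilde n \<omega>) = subvec (- b) \<theta>})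
          \<longlonglongrightarrow> 1) \<and>
      conv_in_distribution (P \<theta>) (\<lambda>n \<omega>. r n *\<^sub>R (\<theta>tilde n \<omega> - \<theta>))
        (Q \<theta>) (\<lambda>\<omega>. subvec {j. \<theta> $ j \<noteq> c $ j} (Z_check {j. \<theta> $ j \<noteq> c $ j} (V \<theta>) (Z \<theta> \<omega>)))"
proof (intro ballI conjI allI impI)
  fix \<theta> assume \<theta>: "\<theta> \<in> \<Theta>"
  interpret P: prob_space "P \<theta>" by (rule prob_P[OF \<theta>])
  note [measurable] = meas_\<theta>hat[OF \<theta>] meas_Vinv_hat[OF \<theta>]
  have [measurable]: "\<theta>tilde n \<in> borel_measurable (P \<theta>)" for n
    unfolding \<theta>tilde by measurable
  define b0 where "b0 = {j. \<theta> $ j \<noteq> c $ j}"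
  \<comment> \<open>Both claims rest on this event of wrong selection being asymptotically
    negligible: its complement lies in the event of the first claim, and it is the exceptional set
    in Slutsky's theorem.\<close>
  define E where "E n = {\<omega> \<in> space (P \<theta>). selected c (a n) (\<theta>hat n \<omega>) \<noteq> b0}" for n
  have [measurable]: "E n \<in> sets (P \<theta>)" for n
    unfolding E_def by measurable
  have E_lim: "(\<lambda>n. measure (P \<theta>) (E n)) \<longlonglongrightarrow> 0"
  proof (rule tendstoI)
    fix e :: real assume "e > 0"
    then obtain K where K: "\<forall>\<^sub>F n in sequentially.
        measure (P \<theta>) {\<omega> \<in> space (P \<theta>). norm (r n *\<^sub>R (\<theta>hat n \<omega> - \<theta>)) > K} < e"
      using conv_in_distribution_tight[OF prob_P[OF \<theta>] prob_Q[OF \<theta>] conv_\<theta>hat[OF \<theta>]] by blast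
    from K eventually_selected_eq[OF r_lim a_max a_min, of \<theta> K c]
    show "\<forall>\<^sub>F n in sequentially. dist (measure (P \<theta>) (E n)) 0 < e"
    proof eventually_elim
      case (elim n)
      have "measure (P \<theta>) (E n) \<le>
          measure (P \<theta>) {\<omega> \<in> space (P \<theta>). norm (r n *\<^sub>R (\<theta>hat n \<omega> - \<theta>)) > K}"
      proof (rule P.finite_measure_mono)
        show "E n \<subseteq> {\<omega> \<in> space (P \<theta>). norm (r n *\<^sub>R (\<theta>hat n \<omega> - \<theta>)) > K}"
          using elim(2) unfolding E_def b0_def by (blast intro: not_le_imp_less)
      qed measurable
      with elim(1) show ?case by simp
    qed
  qed
  {
    fix b assume b: "subvec (- b) \<theta> = subvec (- b) c"
    let ?A = "\<lambda>n. {\<omega> \<in> space (P \<theta>). subvec (- b) (\<theta>tilde n \<omega>) = subvec (- b) \<theta>}"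
    have subvec_meas [measurable]: "subvec (- b) \<in> borel_measurable (borel :: (real ^ 'd) measure)"
      by (intro borel_measurable_continuous_onI continuous_intros)
    \<comment> \<open>The assumption on \<open>b\<close> amounts to \<open>b0 \<subseteq> b\<close>.
      Under correct selection each coordinate outside \<open>b\<close> is therefore set to
      \<open>c $ j\<close>, which equals \<open>\<theta> $ j\<close>.\<close>
    have "1 - measure (P \<theta>) (E n) \<le> measure (P \<theta>) (?A n)" for n
    proof -
      have "j \<notin> b0 \<and> c $ j = \<theta> $ j" if "j \<notin> b" for j
      proof -
        have "subvec (- b) \<theta> $ j = subvec (- b) c $ j" by (simp add: b)
        with that show ?thesis by (simp add: subvec_def b0_def)
      qed
      then have "space (P \<theta>) - E n \<subseteq> ?A n"
        by (auto simp: E_def \<theta>tilde oracle_hodges_eq vec_eq_iff subvec_def)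
      then have "measure (P \<theta>) (space (P \<theta>) - E n) \<le> measure (P \<theta>) (?A n)"
        by (rule P.finite_measure_mono) measurable
      then show ?thesis by (simp add: P.prob_compl)
    qed
    moreover have "(\<lambda>n. 1 - measure (P \<theta>) (E n)) \<longlonglongrightarrow> 1"
      using tendsto_diff[OF tendsto_const E_lim, of 1] by simp
    ultimately show "(\<lambda>n. measure (P \<theta>) (?A n)) \<longlonglongrightarrow> 1"
      using tendsto_sandwich[of "\<lambda>n. 1 - measure (P \<theta>) (E n)" "\<lambda>n. measure (P \<theta>) (?A n)" sequentially "\<lambda>n. 1" 1]
      by simp
  }
  \<comment> \<open>Used twice: for continuity of the coefficient matrix at its limit and for
    identifying the limit law with \<open>Z_check\<close>.\<close>
  have pad: "invertible (padded_block b0 (V \<theta>))"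
    using precision_matrix_pos_def[OF prob_Q meas_Z sq_int_Z mean_Z inv_V cov_Z, OF \<theta> \<theta> \<theta> \<theta> \<theta> \<theta>]
    by (rule invertible_padded_block_pos_def)
  have coeff_lim: "conv_in_probability (P \<theta>) (\<lambda>n \<omega>. restricted_coeff b0 (matrix_inv (Vinv_hat n \<omega>)))
      (restricted_coeff b0 (V \<theta>))"
    using conv_in_probability_isCont[OF prob_P[OF \<theta>] meas_Vinv_hat[OF \<theta>] consistent_Vinv_hat[OF \<theta>]
      isCont_restricted_coeff_matrix_inv[OF inv_V[OF \<theta>] pad]]
    by (simp add: matrix_inv_involutory inv_V[OF \<theta>])
  \<comment> \<open>In Slutsky's theorem the estimated coefficient matrix is the component with
    constant limit, and the normalized initial error is the one converging in distribution.\<close>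
  let ?h = "\<lambda>(A, x). subvec b0 (A *v x)"
  have "conv_in_distribution (P \<theta>) (\<lambda>n \<omega>. r n *\<^sub>R (\<theta>tilde n \<omega> - \<theta>)) (Q \<theta>)
      (\<lambda>\<omega>. ?h (restricted_coeff b0 (V \<theta>), Z \<theta> \<omega>))"
  proof (rule conv_in_distribution_slutsky[OF prob_P[OF \<theta>] prob_Q[OF \<theta>] conv_\<theta>hat[OF \<theta>] _ coeff_lim])
    show "continuous_on UNIV ?h"
      by (auto simp: split_beta intro!: continuous_intros)
    show "r n *\<^sub>R (\<theta>tilde n \<omega> - \<theta>) =
        ?h (restricted_coeff b0 (matrix_inv (Vinv_hat n \<omega>)), r n *\<^sub>R (\<theta>hat n \<omega> - \<theta>))"
      if "\<omega> \<in> space (P \<theta>)" "\<omega> \<notin> E n" for n \<omega>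
      using that scaled_oracle_hodges_error[of c "a n" "\<theta>hat n \<omega>" \<theta>]
      by (simp add: E_def b0_def \<theta>tilde)
    show "(\<lambda>n. measure (P \<theta>) (E n)) \<longlonglongrightarrow> 0" by (rule E_lim)
    show "(\<lambda>\<omega>. restricted_coeff b0 (matrix_inv (Vinv_hat n \<omega>))) \<in> borel_measurable (P \<theta>)" for n
      by measurable
    show "(\<lambda>\<omega>. r n *\<^sub>R (\<theta>tilde n \<omega> - \<theta>)) \<in> borel_measurable (P \<theta>)" for n
      by measurable
    show "E n \<in> sets (P \<theta>)" for n
      by measurable
  qed
  then show "conv_in_distribution (P \<theta>) (\<lambda>n \<omega>. r n *\<^sub>R (\<theta>tilde n \<omega> - \<theta>))
        (Q \<theta>) (\<lambda>\<omega>. subvec {j. \<theta> $ j \<noteq> c $ j} (Z_check {j. \<theta> $ j \<noteq> c $ j} (V \<theta>) (Z \<theta> \<omega>)))"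
    using pad by (simp add: Z_check_eq_restricted_coeff b0_def)
qed

end
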